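(* Let $n,m\ge1$, $\alpha\in\mathbb R$ and $u\in C_c^{2m}(\mathbb R^n\setminus\{0\})$. Then $$\|\Delta^m u\|_\alpha^2=H_{m-1,\alpha}\|u\|_{\alpha+4m}^2+\sum_{k=1}^m H_{k-2,\alpha}\Big[D_{\alpha+4k-4}\big\|T_{\alpha+4k-2}(\Delta^{m-k}u)\big\|_{\alpha+4k-2}^2+\big\|R_{\alpha+4k-4,1}(\Delta^{m-k}u)\big\|_{\alpha+4k-4}^2$$ $$+\big\|(\Delta-\Delta_r)(\Delta^{m-k}u)\big\|_{\alpha+4k-4}^2+2\sum_{j=1}^n\big\|T_{\alpha+4k-4}\big(L_j(\Delta^{m-k}u)\big)\big\|_{\alpha+4k-4}^2+2A_{\alpha+4k-4}\sum_{j=1}^n\big\|L_j(\Delta^{m-k}u)\big\|_{\alpha+4k-2}^2\Big],$$ where $H_{-1,\alpha}=1$ and $H_{k,\alpha}=\prod_{\ell=0}^{k}A_{\alpha+4\ell}^2$ for integers $k\ge0$.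
   Context: Let $n\ge1$ and write $r=|x|$ for $x\in\mathbb R^n$. For $\beta\in\mathbb R$ and $g$ continuous with compact support in $\mathbb R^n\setminus\{0\}$, set $\|g\|_\beta^2=\int_{\mathbb R^n}|g(x)|^2|x|^{-\beta}\,dx$. Let $\partial_r=\sum_{i=1}^n\frac{x_i}{r}\partial_{x_i}$, $\Delta_r=\partial_r^2+\frac{n-1}{r}\partial_r$ (radial Laplacian), $\Delta$ the usual Laplacian, and $L_j=\partial_{x_j}-\frac{x_j}{r}\partial_r$ for $1\le j\le n$. For $\alpha\in\mathbb R$, $T_\alpha f=\partial_r f+\frac{n-2-\alpha}{2r}f$, and $R_{\alpha,1}=T_\alpha\circ T_{\alpha+2}$. For $\beta\in\mathbb R$, $A_\beta=\frac{(n+\beta)(n-4-\beta)}{4}$ and $D_\beta=\frac{(n+\beta)^2+(n-4-\beta)^2}{4}$. *)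

theory Defs
  imports "HOL-Analysis.Analysis"
begin

definition partial :: "'n::finite \<Rightarrow> (real^'n \<Rightarrow> real) \<Rightarrow> real^'n \<Rightarrow> real" where
  "partial i f x = frechet_derivative f (at x) (axis i 1)"

fun Ck :: "nat \<Rightarrow> (real^'n::finite \<Rightarrow> real) \<Rightarrow> bool" where
  "Ck 0 f = continuous_on UNIV f"
| "Ck (Suc k) f = (continuous_on UNIV f \<and> (\<forall>x. f differentiable at x) \<and> (\<forall>i. Ck k (partial i f)))"

definition compact_support_away0 :: "(real^'n::finite \<Rightarrow> real) \<Rightarrow> bool" where
  "compact_support_away0 f \<longleftrightarrow>
     compact (closure {x. f x \<noteq> 0}) \<and> 0 \<notin> closure {x. f x \<noteq> 0}"

definition wnorm2 :: "real \<Rightarrow> (real^'n::finite \<Rightarrow> real) \<Rightarrow> real" where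
  "wnorm2 \<beta> g = (LINT x|lborel. (g x)\<^sup>2 * norm x powr (-\<beta>))"

definition radial_deriv :: "(real^'n::finite \<Rightarrow> real) \<Rightarrow> real^'n \<Rightarrow> real" where
  "radial_deriv f x = (\<Sum>i\<in>UNIV. (x $ i / norm x) * partial i f x)"

definition lap :: "(real^'n::finite \<Rightarrow> real) \<Rightarrow> real^'n \<Rightarrow> real" where
  "lap f x = (\<Sum>i\<in>UNIV. partial i (partial i f) x)"

definition lap_r :: "(real^'n::finite \<Rightarrow> real) \<Rightarrow> real^'n \<Rightarrow> real" where
  "lap_r f x = radial_deriv (radial_deriv f) x
      + (real CARD('n) - 1) / norm x * radial_deriv f x"

definition Lop :: "'n::finite \<Rightarrow> (real^'n \<Rightarrow> real) \<Rightarrow> real^'n \<Rightarrow> real" where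
  "Lop j f x = partial j f x - (x $ j / norm x) * radial_deriv f x"

definition Top :: "real \<Rightarrow> (real^'n::finite \<Rightarrow> real) \<Rightarrow> real^'n \<Rightarrow> real" where
  "Top \<alpha> f x = radial_deriv f x + (real CARD('n) - 2 - \<alpha>) / (2 * norm x) * f x"

definition R1 :: "real \<Rightarrow> (real^'n::finite \<Rightarrow> real) \<Rightarrow> real^'n \<Rightarrow> real" where
  "R1 \<alpha> f = Top \<alpha> (Top (\<alpha> + 2) f)"

definition Acoef :: "nat \<Rightarrow> real \<Rightarrow> real" where
  "Acoef n \<beta> = (real n + \<beta>) * (real n - 4 - \<beta>) / 4"

definition Dcoef :: "nat \<Rightarrow> real \<Rightarrow> real" where
  "Dcoef n \<beta> = ((real n + \<beta>)\<^sup>2 + (real n - 4 - \<beta>)\<^sup>2) / 4"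

text \<open>H n k alpha: for k = -1 the empty product 1; for k >= 0 the product over l = 0..k.\<close>
definition Hcoef :: "nat \<Rightarrow> int \<Rightarrow> real \<Rightarrow> real" where
  "Hcoef n k \<alpha> = (\<Prod>l\<in>{0..k}. (Acoef n (\<alpha> + 4 * real_of_int l))\<^sup>2)"

end

theory Submission
  imports Defs
begin

text \<open>
  Iterating the case \<open>m = 1\<close> gives the theorem. For \<open>m = 1\<close>, put \<open>\<gamma> = \<beta> + 4\<close> and multiply all
  operators by the power of \<open>r\<close> that makes them homogeneous of degree 0. With
  \<open>E = r \<partial>_r\<close> and \<open>c = (n - \<gamma>) / 2\<close>, the operator \<open>G = E + c\<close> is skew for
  \<open>\<langle>f, g\<rangle> = \<integral> f g r^(-\<gamma>)\<close>, and \<open>r\<^sup>2 \<Delta>_r = G\<^sup>2 + (d - c) G - c d\<close> with \<open>d = (n + \<beta>) / 2\<close>,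
  so that \<open>A_\<beta> = c d\<close> and \<open>D_\<beta> = c\<^sup>2 + d\<^sup>2\<close>. Writing \<open>M_j = r L_j\<close> and \<open>S = r\<^sup>2 (\<Delta> - \<Delta>_r)\<close>, one has
  \<open>\<langle>f, S v\<rangle> = - \<Sum>_j \<langle>M_j f, M_j v\<rangle>\<close>, and the cross terms with \<open>S v\<close> follow from it.

  The term \<open>\<langle>G\<^sup>2 v, S v\<rangle> = \<Sum>_j \<parallel>G M_j v\<parallel>\<^sup>2\<close> formally involves third derivatives of \<open>v\<close>, which is
  only \<open>C\<^sup>2\<close>. They are avoided by using the unitary dilation group \<open>U_t\<close> generated by \<open>G\<close>: it
  commutes with \<open>M_j\<close>, hence \<open>\<langle>U_t v, S v\<rangle> = - \<Sum>_j \<langle>U_t M_j v, M_j v\<rangle>\<close>. Differentiating once in \<open>t\<close>,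
  moving \<open>U_t\<close> to the other side, and differentiating again at \<open>t = 0\<close> gives the claim.
\<close>

section \<open>Functions supported away from the origin\<close>

text \<open>The class C_c^k of the punctured space: extension by zero makes such a function C^k on
  the whole space, so regularity can be stated globally.\<close>

definition Ck_away0 :: "nat \<Rightarrow> (real^'n::finite \<Rightarrow> real) \<Rightarrow> bool" where
  "Ck_away0 k f \<longleftrightarrow> Ck k f \<and> compact_support_away0 f"

text \<open>Class of multipliers such as powers of \<open>norm x\<close>, which may be singular at
  0; they are only multiplied with functions vanishing near 0.\<close>

definition C1_off0 :: "(real^'n::finite \<Rightarrow> real) \<Rightarrow> bool" where
  "C1_off0 h \<longleftrightarrow> (\<forall>x. x \<noteq> 0 \<longrightarrow> h differentiable at x) \<and> (\<forall>i. continuous_on (-{0}) (partial i h))"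

text \<open>Containment in a closed annulus is a pointwise condition, so closure properties reduce
  to comparing radii instead of arguing with closures.\<close>

lemma compact_support_away0_iff:
  fixes f :: "real^'n::finite \<Rightarrow> real"
  shows "compact_support_away0 f \<longleftrightarrow> (\<exists>a>0. \<exists>b. \<forall>x. f x \<noteq> 0 \<longrightarrow> a \<le> norm x \<and> norm x \<le> b)"
proof
  let ?S = "closure {x. f x \<noteq> 0}"
  assume "compact_support_away0 f"
  then have c: "compact ?S" and z: "0 \<notin> ?S"
    by (auto simp: compact_support_away0_def)
  obtain b where b: "\<And>x. x \<in> ?S \<Longrightarrow> norm x \<le> b"
    using compact_imp_bounded[OF c] by (auto simp: bounded_iff)
  obtain a where a: "a > 0" "\<And>x. x \<in> ?S \<Longrightarrow> a \<le> dist 0 x"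
    using separate_point_closed[OF closed_closure z] by blast
  have "\<And>x. f x \<noteq> 0 \<Longrightarrow> x \<in> ?S"
    by (simp add: closure_def)
  with a b show "\<exists>a>0. \<exists>b. \<forall>x. f x \<noteq> 0 \<longrightarrow> a \<le> norm x \<and> norm x \<le> b"
    by (metis dist_0_norm)
next
  assume "\<exists>a>0. \<exists>b. \<forall>x. f x \<noteq> 0 \<longrightarrow> a \<le> norm x \<and> norm x \<le> b"
  then obtain a b where a: "a > 0" and ab: "\<And>x. f x \<noteq> 0 \<Longrightarrow> a \<le> norm x \<and> norm x \<le> b"
    by blast
  let ?A = "cball 0 b \<inter> {x. a \<le> norm x} :: (real^'n) set"
  have cl: "closed {x::real^'n. a \<le> norm x}"
    by (intro closed_Collect_le continuous_intros)
  have "closure {x. f x \<noteq> 0} \<subseteq> ?A"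
    using ab by (intro closure_minimal closed_Int closed_cball cl) auto
  moreover have "compact ?A"
    by (intro compact_Int_closed compact_cball cl)
  ultimately show "compact_support_away0 f"
    using a unfolding compact_support_away0_def
    by (metis (no_types, lifting) IntE closed_closure compact_Int_closed inf.absorb2 mem_Collect_eq norm_zero not_le subsetD)
qed

lemma compact_support_away0_mono:
  fixes f g :: "real^'n::finite \<Rightarrow> real"
  assumes "compact_support_away0 f" "\<And>x. f x = 0 \<Longrightarrow> g x = 0"
  shows "compact_support_away0 g"
  using assms unfolding compact_support_away0_iff by metis

lemma compact_support_away0_add:
  fixes f g :: "real^'n::finite \<Rightarrow> real"
  assumes "compact_support_away0 f" "compact_support_away0 g"
  shows "compact_support_away0 (\<lambda>x. f x + g x)"
proof -
  obtain a b where "a > 0" "\<And>x. f x \<noteq> 0 \<Longrightarrow> a \<le> norm x \<and> norm x \<le> b"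
    using assms(1) unfolding compact_support_away0_iff by blast
  moreover obtain a' b' where "a' > 0" "\<And>x. g x \<noteq> 0 \<Longrightarrow> a' \<le> norm x \<and> norm x \<le> b'"
    using assms(2) unfolding compact_support_away0_iff by blast
  ultimately have "min a a' > 0 \<and> (\<forall>x. f x + g x \<noteq> 0 \<longrightarrow> min a a' \<le> norm x \<and> norm x \<le> max b b')"
    by (metis add.right_neutral le_max_iff_disj min_le_iff_disj min_less_iff_conj)
  then show ?thesis
    unfolding compact_support_away0_iff by blast
qed

lemma compact_support_away0_near_0:
  fixes f :: "real^'n::finite \<Rightarrow> real"
  assumes "compact_support_away0 f"
  obtains a where "a > 0" "\<And>x. norm x < a \<Longrightarrow> f x = 0"
  using assms unfolding compact_support_away0_iff by (metis not_le)

lemma compact_support_away0_zero [simp]: "compact_support_away0 f \<Longrightarrow> f 0 = 0"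
  by (metis compact_support_away0_near_0 norm_zero)

section \<open>Partial derivatives and the classes C^k\<close>

lemma partial_eqI: "(f has_derivative f') (at x) \<Longrightarrow> partial i f x = f' (axis i 1)"
  unfolding partial_def using frechet_derivative_at by metis

lemma frechet_derivative_eq_sum_partial:
  assumes "f differentiable at (x::real^'n::finite)"
  shows "frechet_derivative f (at x) h = (\<Sum>i\<in>UNIV. h $ i * partial i f x)"
proof -
  interpret linear "frechet_derivative f (at x)"
    by (rule linear_frechet_derivative[OF assms])
  have "frechet_derivative f (at x) (\<Sum>i\<in>UNIV. (h $ i) *\<^sub>R axis i 1) = (\<Sum>i\<in>UNIV. h $ i * partial i f x)"
    unfolding sum by (simp add: scaleR partial_def)
  then show ?thesis
    by (simp add: basis_expansion[of h, unfolded scalar_mult_eq_scaleR])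
qed

lemma has_derivative_locally_zero:
  assumes "open S" "x \<in> S" "\<And>y. y \<in> S \<Longrightarrow> f y = (0::real)"
  shows "(f has_derivative (\<lambda>_. 0)) (at (x::real^'n::finite))"
  using has_derivative_transform_within_open[OF has_derivative_const assms(1,2), of 0 f] assms(3) by simp

text \<open>The same annulus works: outside it \<open>f\<close> vanishes on an open set, and so does
  its derivative.\<close>

lemma compact_support_away0_partial:
  fixes f :: "real^'n::finite \<Rightarrow> real"
  assumes "compact_support_away0 f"
  shows "compact_support_away0 (partial i f)"
proof -
  obtain a b where a: "a > 0" and ab: "\<And>x. f x \<noteq> 0 \<Longrightarrow> a \<le> norm x \<and> norm x \<le> b"
    using assms unfolding compact_support_away0_iff by blast
  have "open {x::real^'n. norm x < a}" "open {x::real^'n. b < norm x}"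
    by (intro open_Collect_less continuous_intros)+
  then have "partial i f x = 0" if "norm x < a \<or> b < norm x" for x
    using that partial_eqI[OF has_derivative_locally_zero[of _ x f]] ab by (metis mem_Collect_eq not_le)
  with a show ?thesis
    unfolding compact_support_away0_iff by (metis not_le)
qed

lemma Ck_imp_continuous: "Ck k f \<Longrightarrow> continuous_on UNIV f"
  by (cases k) auto

lemma Ck_SucD: "Ck (Suc k) f \<Longrightarrow> Ck k f"
proof (induction k arbitrary: f)
  case (Suc k)
  then show ?case by simp
qed simp

lemma Ck_mono: "Ck l f \<Longrightarrow> k \<le> l \<Longrightarrow> Ck k f"
  by (induction l) (auto simp del: Ck.simps simp: le_Suc_eq dest: Ck_SucD)

lemma Ck_away0_mono: "Ck_away0 l f \<Longrightarrow> k \<le> l \<Longrightarrow> Ck_away0 k f"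
  by (auto simp: Ck_away0_def dest: Ck_mono)

lemma Ck_away0_partial: "Ck_away0 (Suc k) f \<Longrightarrow> Ck_away0 k (partial i f)"
  by (simp add: Ck_away0_def compact_support_away0_partial)

lemma Ck_away0_continuous: "Ck_away0 k f \<Longrightarrow> continuous_on S f"
  using Ck_imp_continuous continuous_on_subset by (fastforce simp: Ck_away0_def)

lemma Ck_away0_0 [simp]: "Ck_away0 k f \<Longrightarrow> f 0 = 0"
  by (simp add: Ck_away0_def)

lemma partial_add:
  assumes "f differentiable at x" "g differentiable at x"
  shows "partial i (\<lambda>x. f x + g x) x = partial i f x + partial i g x"
  using partial_eqI[OF has_derivative_add[OF assms[unfolded frechet_derivative_works]]]
  by (simp add: partial_def)

lemma partial_mult:
  assumes "f differentiable at x" "g differentiable at x"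
  shows "partial i (\<lambda>x. f x * g x) x = partial i f x * g x + f x * partial i g x"
  using partial_eqI[OF has_derivative_mult[OF assms[unfolded frechet_derivative_works]]]
  by (simp add: partial_def)

lemma Ck_add: "Ck k f \<Longrightarrow> Ck k g \<Longrightarrow> Ck k (\<lambda>x. f x + g x)"
proof (induction k arbitrary: f g)
  case 0
  then show ?case by (auto intro: continuous_intros)
next
  case (Suc k)
  have "partial i (\<lambda>x. f x + g x) = (\<lambda>x. partial i f x + partial i g x)" for i
    using Suc.prems by (auto simp: partial_add)
  then show ?case
    using Suc by (auto intro: continuous_on_add)
qed

lemma Ck_away0_add: "Ck_away0 k f \<Longrightarrow> Ck_away0 k g \<Longrightarrow> Ck_away0 k (\<lambda>x. f x + g x)"
  by (simp add: Ck_away0_def Ck_add compact_support_away0_add)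

lemma Ck_zero: "Ck k (\<lambda>x. 0)"
proof (induction k)
  case (Suc k)
  have "partial i (\<lambda>x. 0) = (\<lambda>x. 0)" for i :: 'a
    by (simp add: fun_eq_iff partial_def)
  with Suc show ?case by simp
qed simp

lemma Ck_away0_zero: "Ck_away0 k (\<lambda>x. 0)"
  by (simp add: Ck_away0_def Ck_zero compact_support_away0_def)

lemma Ck_away0_sum: "(\<And>i. i \<in> I \<Longrightarrow> Ck_away0 k (f i)) \<Longrightarrow> Ck_away0 k (\<lambda>x. \<Sum>i\<in>I. f i x)"
  by (induction I rule: infinite_finite_induct) (auto intro: Ck_away0_zero Ck_away0_add)

lemma Ck_away0_lap: "Ck_away0 (Suc (Suc k)) f \<Longrightarrow> Ck_away0 k (lap f)"
  unfolding lap_def[abs_def] by (intro Ck_away0_sum Ck_away0_partial)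

lemma Ck_away0_lap_funpow: "Ck_away0 (2 * m) u \<Longrightarrow> k \<le> m \<Longrightarrow> Ck_away0 (2 * (m - k)) ((lap ^^ k) u)"
proof (induction k)
  case (Suc k)
  then have "Ck_away0 (2 * (m - k)) ((lap ^^ k) u)" by simp
  moreover have "2 * (m - k) = Suc (Suc (2 * (m - Suc k)))" using Suc.prems by simp
  ultimately show ?case by (simp add: Ck_away0_lap)
qed simp

section \<open>Products with functions regular off the origin\<close>

lemma C1_off0_continuous: "C1_off0 h \<Longrightarrow> continuous_on (-{0}) h"
  unfolding C1_off0_def
  by (intro differentiable_imp_continuous_on) (auto simp: differentiable_on_def differentiable_at_withinI)

text \<open>The space is covered by two open sets: the punctured space, where both factors are
  continuous, and a ball around 0, where the product is 0.\<close>

lemma continuous_on_mult_away0: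
  fixes f g :: "real^'n::finite \<Rightarrow> real"
  assumes f: "continuous_on UNIV f" "compact_support_away0 f" and g: "continuous_on (-{0}) g"
  shows "continuous_on UNIV (\<lambda>x. f x * g x)"
proof -
  obtain a where a: "a > 0" "\<And>x. norm x < a \<Longrightarrow> f x = 0"
    using compact_support_away0_near_0[OF f(2)] by metis
  have "continuous_on (-{0} \<union> ball 0 a) (\<lambda>x. f x * g x)"
  proof (rule continuous_on_open_Un)
    show "continuous_on (-{0}) (\<lambda>x. f x * g x)"
      by (intro continuous_intros g continuous_on_subset[OF f(1)]) auto
    have "continuous_on (ball 0 a) (\<lambda>x. f x * g x) \<longleftrightarrow> continuous_on (ball (0::real^'n) a) (\<lambda>x. 0::real)"
      using a(2) by (intro continuous_on_cong) auto
    then show "continuous_on (ball 0 a) (\<lambda>x. f x * g x)"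
      by simp
  qed auto
  moreover have "-{0} \<union> ball 0 a = (UNIV::(real^'n) set)"
    using a(1) by auto
  ultimately show ?thesis by simp
qed

lemma Ck_away0_mult_continuous:
  assumes "Ck_away0 k f" "continuous_on (-{0}) g"
  shows "Ck_away0 0 (\<lambda>x. f x * g x)"
  using assms continuous_on_mult_away0[OF Ck_imp_continuous] compact_support_away0_mono[of f]
  by (auto simp: Ck_away0_def)

text \<open>The product rule holds even at 0, whatever \<open>g\<close> and
  \<open>partial i g\<close> are there: \<open>f\<close> vanishes near 0, so both sides are
  0.\<close>

lemma Ck_away0_mult_C1:
  fixes f g :: "real^'n::finite \<Rightarrow> real"
  assumes f: "Ck_away0 1 f" and g: "C1_off0 g"
  shows partial_mult_C1: "partial i (\<lambda>x. f x * g x) x = partial i f x * g x + f x * partial i g x"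
    and "Ck_away0 1 (\<lambda>x. f x * g x)"
proof -
  obtain a where a: "a > 0" "\<And>x. norm x < a \<Longrightarrow> f x = 0"
    using compact_support_away0_near_0 f unfolding Ck_away0_def by metis
  have d0: "((\<lambda>x. f x * g x) has_derivative (\<lambda>_. 0)) (at 0)"
    using a by (intro has_derivative_locally_zero[of "ball 0 a"]) auto
  have p: "partial i (\<lambda>x. f x * g x) x = partial i f x * g x + f x * partial i g x" for i x
  proof (cases "x = 0")
    case True
    with f show ?thesis
      using partial_eqI[OF d0] Ck_away0_0[OF Ck_away0_partial, of 0 f] by simp
  next
    case False
    with f g show ?thesis
      by (intro partial_mult) (auto simp: Ck_away0_def C1_off0_def)
  qed
  then show "partial i (\<lambda>x. f x * g x) x = partial i f x * g x + f x * partial i g x" .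
  have "(\<lambda>x. f x * g x) differentiable at x" for x
    using f g differentiableI[OF d0]
    by (cases "x = 0") (auto simp: Ck_away0_def C1_off0_def)
  moreover have "Ck_away0 0 (partial i (\<lambda>x. f x * g x))" for i
    unfolding p using f g
    by (intro Ck_away0_add Ck_away0_mult_continuous[of 0 "partial i f"] Ck_away0_mult_continuous[of 1 f] C1_off0_continuous[of g])
       (auto simp: C1_off0_def intro: Ck_away0_partial)
  moreover have "Ck_away0 0 (\<lambda>x. f x * g x)"
    using f g by (intro Ck_away0_mult_continuous[of 1 f] C1_off0_continuous)
  ultimately show "Ck_away0 1 (\<lambda>x. f x * g x)"
    by (simp add: Ck_away0_def)
qed

lemma C1_off0_const: "C1_off0 (\<lambda>x. c)"
  by (simp add: C1_off0_def partial_def)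

lemma partial_component: "partial i (\<lambda>x::real^'n::finite. x $ j) x = (if i = j then 1 else 0)"
  by (subst partial_eqI[OF bounded_linear.has_derivative[OF bounded_linear_vec_nth has_derivative_ident]])
     (simp add: axis_def)

lemma C1_off0_component: "C1_off0 (\<lambda>x. x $ j)"
  using bounded_linear_imp_differentiable[OF bounded_linear_vec_nth]
  by (auto simp: C1_off0_def partial_component)

lemma has_derivative_norm_powr:
  assumes "x \<noteq> (0::real^'n::finite)"
  shows "((\<lambda>x. norm x powr s) has_derivative (\<lambda>h. s * (x \<bullet> h) * norm x powr (s - 2))) (at x)"
proof -
  have "((\<lambda>x. norm x powr s) has_derivative (\<lambda>h. norm x powr s * ((sgn x \<bullet> h) * s / norm x))) (at x)"
    using has_derivative_powr[OF has_derivative_norm[OF assms] has_derivative_const, of s] assms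
    by (simp add: inner_commute)
  moreover have "norm x powr s * ((sgn x \<bullet> h) * s / norm x) = s * (x \<bullet> h) * norm x powr (s - 2)" for h
    using assms by (simp add: sgn_div_norm powr_diff field_simps power2_eq_square)
  ultimately show ?thesis by simp
qed

lemma partial_norm_powr:
  "x \<noteq> 0 \<Longrightarrow> partial i (\<lambda>x. norm x powr s) x = s * x $ i * norm x powr (s - 2)"
  using partial_eqI[OF has_derivative_norm_powr, of x i s] by (simp add: inner_axis)

lemma C1_off0_norm_powr: "C1_off0 (\<lambda>x::real^'n::finite. norm x powr s)"
proof -
  have "continuous_on (-{0}) (partial i (\<lambda>x. norm x powr s)) \<longleftrightarrow>
        continuous_on (-{0}) (\<lambda>x::real^'n. s * x $ i * norm x powr (s - 2))" for i
    by (intro continuous_on_cong) (auto simp: partial_norm_powr)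
  moreover have "continuous_on (-{0}) (\<lambda>x::real^'n. s * x $ i * norm x powr (s - 2))" for i
    by (intro continuous_intros) auto
  ultimately show ?thesis
    unfolding C1_off0_def by (auto intro: differentiableI has_derivative_norm_powr)
qed

lemma Ck_away0_mult_powr: "Ck_away0 1 f \<Longrightarrow> Ck_away0 1 (\<lambda>x. f x * norm x powr s)"
  by (rule Ck_away0_mult_C1(2)[OF _ C1_off0_norm_powr])

lemma Ck_away0_mult_component: "Ck_away0 1 f \<Longrightarrow> Ck_away0 1 (\<lambda>x. f x * x $ j)"
  by (rule Ck_away0_mult_C1(2)[OF _ C1_off0_component])

lemma Ck_away0_cmult: "Ck_away0 1 f \<Longrightarrow> Ck_away0 1 (\<lambda>x. c * f x)"
  using Ck_away0_mult_C1(2)[OF _ C1_off0_const, of f c] by (simp add: mult.commute)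

lemma C0_away0_cmult: "Ck_away0 0 f \<Longrightarrow> Ck_away0 0 (\<lambda>x. c * f x)"
  using Ck_away0_mult_continuous[of 0 f "\<lambda>_. c"] by (simp add: mult.commute)

lemma C0_away0_mult: "Ck_away0 0 f \<Longrightarrow> Ck_away0 0 g \<Longrightarrow> Ck_away0 0 (\<lambda>x. f x * g x)"
  by (rule Ck_away0_mult_continuous) (auto intro: Ck_away0_continuous)

lemma C1_away0_imp_C1_off0: "Ck_away0 1 g \<Longrightarrow> C1_off0 g"
  by (auto simp: C1_off0_def Ck_away0_def intro: continuous_on_subset)

lemma C1_away0_mult: "Ck_away0 1 f \<Longrightarrow> Ck_away0 1 g \<Longrightarrow> Ck_away0 1 (\<lambda>x. f x * g x)"
  by (intro Ck_away0_mult_C1(2) C1_away0_imp_C1_off0)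

section \<open>Euler operator, dilations and the weighted inner product\<close>

definition euler :: "(real^'n::finite \<Rightarrow> real) \<Rightarrow> real^'n \<Rightarrow> real" where
  "euler f x = (\<Sum>i\<in>UNIV. x $ i * partial i f x)"

definition skew_euler :: "real \<Rightarrow> (real^'n::finite \<Rightarrow> real) \<Rightarrow> real^'n \<Rightarrow> real" where
  "skew_euler \<gamma> f x = euler f x + (real CARD('n) - \<gamma>) / 2 * f x"

text \<open>\<open>angular_grad j\<close> is \<open>r L_j\<close>; unlike \<open>L_j\<close> it commutes with dilations.\<close>

definition angular_grad :: "'n::finite \<Rightarrow> (real^'n \<Rightarrow> real) \<Rightarrow> real^'n \<Rightarrow> real" where
  "angular_grad j f x = norm x * partial j f x - x $ j / norm x * euler f x"

text \<open>The exponential prefactor makes \<open>dilation \<gamma>\<close> a unitary group for \<open>wdot \<gamma>\<close>,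
  generated by \<open>skew_euler \<gamma>\<close>.\<close>

definition dilation :: "real \<Rightarrow> real \<Rightarrow> (real^'n::finite \<Rightarrow> real) \<Rightarrow> real^'n \<Rightarrow> real" where
  "dilation \<gamma> t f x = exp ((real CARD('n) - \<gamma>) / 2 * t) * f (exp t *\<^sub>R x)"

definition wdot :: "real \<Rightarrow> (real^'n::finite \<Rightarrow> real) \<Rightarrow> (real^'n \<Rightarrow> real) \<Rightarrow> real" where
  "wdot \<gamma> f g = (LINT x|lborel. f x * g x * norm x powr (-\<gamma>))"

lemma wnorm2_eq_wdot: "wnorm2 \<gamma> f = wdot \<gamma> f f"
  by (simp add: wnorm2_def wdot_def power2_eq_square)

lemma wdot_commute: "wdot \<gamma> f g = wdot \<gamma> g f"
  by (simp add: wdot_def mult.commute)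

lemma C0_away0_euler: "Ck_away0 1 f \<Longrightarrow> Ck_away0 0 (euler f)"
  unfolding euler_def[abs_def]
  by (subst mult.commute, intro Ck_away0_sum Ck_away0_mult_continuous[of 0] C1_off0_continuous[OF C1_off0_component])
     (auto intro: Ck_away0_partial)

lemma Ck_away0_euler: "Ck_away0 2 f \<Longrightarrow> Ck_away0 1 (euler f)"
  unfolding euler_def[abs_def]
  by (subst mult.commute, intro Ck_away0_sum Ck_away0_mult_component Ck_away0_partial) (simp add: numeral_2_eq_2)

lemma Ck_away0_skew_euler: "Ck_away0 2 f \<Longrightarrow> Ck_away0 1 (skew_euler \<gamma> f)"
  unfolding skew_euler_def[abs_def] by (intro Ck_away0_add Ck_away0_euler Ck_away0_cmult) (auto intro: Ck_away0_mono)

lemma C0_away0_skew_euler: "Ck_away0 1 f \<Longrightarrow> Ck_away0 0 (skew_euler \<gamma> f)"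
  unfolding skew_euler_def[abs_def] by (intro Ck_away0_add C0_away0_euler C0_away0_cmult) (auto intro: Ck_away0_mono)

text \<open>Valid at the origin too, where \<open>0 powr s\<close> and \<open>1 / 0\<close> are both
  0, so rewriting with it has no side condition.\<close>

lemma norm_powr_1: "norm x powr 1 = norm x" "norm x powr (-1) = 1 / norm x"
  by (auto simp: powr_minus field_simps)

lemma angular_grad_alt: "angular_grad j f x = partial j f x * norm x powr 1 + (-1) * (euler f x * norm x powr (-1) * x $ j)"
  unfolding norm_powr_1 by (simp add: angular_grad_def)

lemma Ck_away0_angular_grad: "Ck_away0 2 f \<Longrightarrow> Ck_away0 1 (angular_grad j f)"
  unfolding angular_grad_alt[abs_def]
  by (intro Ck_away0_add Ck_away0_cmult Ck_away0_mult_component Ck_away0_mult_powr Ck_away0_euler Ck_away0_partial) (simp_all add: numeral_2_eq_2)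

text \<open>Euler's relation for the homogeneous function r^s: conjugation by r^s shifts the Euler
  operator by s.\<close>

lemma euler_mult_powr:
  assumes "Ck_away0 1 f"
  shows "euler (\<lambda>x. f x * norm x powr s) x = (euler f x + s * f x) * norm x powr s"
proof (cases "x = 0")
  case False
  have "(\<Sum>i\<in>UNIV. x $ i * x $ i) = (norm x)\<^sup>2"
    by (simp add: power2_norm_eq_inner inner_vec_def)
  moreover have "norm x powr s = (norm x)\<^sup>2 * norm x powr (s - 2)"
    using False by (simp add: powr_diff)
  moreover have "euler (\<lambda>x. f x * norm x powr s) x =
      euler f x * norm x powr s + f x * s * norm x powr (s - 2) * (\<Sum>i\<in>UNIV. x $ i * x $ i)"
    unfolding euler_def partial_mult_C1[OF assms C1_off0_norm_powr] partial_norm_powr[OF False]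
    by (simp add: sum_distrib_left sum_distrib_right sum.distrib algebra_simps)
  ultimately show ?thesis
    by (simp add: algebra_simps)
qed (simp add: euler_def)

section \<open>Weighted integrals of compactly supported functions\<close>

lemma Ck_away0_bounded_support:
  assumes "Ck_away0 k (f :: real^'n::finite \<Rightarrow> real)"
  obtains b where "\<And>x. f x \<noteq> 0 \<Longrightarrow> norm x \<le> b"
  using assms unfolding Ck_away0_def compact_support_away0_iff by metis

text \<open>Bridge from the Lebesgue integral over the space to the gauge integral over a box, for
  which the Leibniz rule is available.\<close>

lemma integrable_continuous_vanishing:
  fixes f :: "'a::euclidean_space \<Rightarrow> real"
  assumes "continuous_on UNIV f" "\<And>x. x \<notin> cbox a b \<Longrightarrow> f x = 0"
  shows "integrable lborel f" "(LINT x|lborel. f x) = integral (cbox a b) f"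
proof -
  have eq: "(\<lambda>x. indicator (cbox a b) x *\<^sub>R f x) = f"
    using assms(2) by (force simp: indicator_def)
  show i: "integrable lborel f"
    using borel_integrable_compact[OF compact_cbox continuous_on_subset[OF assms(1) subset_UNIV], of a b]
    by (simp only: eq)
  have "integral (cbox a b) f = integral UNIV f"
    unfolding integral_restrict_UNIV[of "cbox a b" f, symmetric]
    using assms(2) by (intro Henstock_Kurzweil_Integration.integral_cong) auto
  then show "(LINT x|lborel. f x) = integral (cbox a b) f"
    using integral_lborel[OF i] by simp
qed

lemma norm_le_imp_mem_cbox:
  "norm x \<le> b \<Longrightarrow> x \<in> cbox (- (\<Sum>i\<in>Basis. b *\<^sub>R i)) (\<Sum>i\<in>Basis. b *\<^sub>R (i::'a::euclidean_space))"
  using Basis_le_norm[of _ x] by (fastforce simp: mem_box inner_sum_left_Basis abs_le_iff)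

lemma integrable_Ck_away0: "Ck_away0 k f \<Longrightarrow> integrable lborel f"
  by (metis Ck_away0_bounded_support Ck_away0_continuous integrable_continuous_vanishing(1) norm_le_imp_mem_cbox)

lemma Ck_away0_mult_weight: "Ck_away0 0 f \<Longrightarrow> Ck_away0 0 (\<lambda>x. f x * norm x powr s)"
  by (intro Ck_away0_mult_continuous C1_off0_continuous C1_off0_norm_powr)

lemma integrable_wdot:
  "Ck_away0 0 f \<Longrightarrow> Ck_away0 0 g \<Longrightarrow> integrable lborel (\<lambda>x. f x * g x * norm x powr s)"
  by (intro integrable_Ck_away0[of 0] Ck_away0_mult_weight C0_away0_mult)

lemma wdot_add_left:
  assumes "Ck_away0 0 f" "Ck_away0 0 g" "Ck_away0 0 h"
  shows "wdot \<gamma> (\<lambda>x. f x + g x) h = wdot \<gamma> f h + wdot \<gamma> g h"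
  unfolding wdot_def using assms
  by (subst Bochner_Integration.integral_add[symmetric]) (simp_all add: integrable_wdot distrib_right)

lemma wdot_cmult_left: "wdot \<gamma> (\<lambda>x. c * f x) h = c * wdot \<gamma> f h"
  unfolding wdot_def by (subst integral_mult_right_zero[symmetric]) (simp add: mult.assoc)

lemma wdot_add_right:
  assumes "Ck_away0 0 f" "Ck_away0 0 g" "Ck_away0 0 h"
  shows "wdot \<gamma> h (\<lambda>x. f x + g x) = wdot \<gamma> h f + wdot \<gamma> h g"
  using wdot_add_left[OF assms, of \<gamma>] by (simp add: wdot_commute[of \<gamma> h])

lemma wdot_cmult_right: "wdot \<gamma> h (\<lambda>x. c * f x) = c * wdot \<gamma> h f"
  using wdot_cmult_left[of \<gamma> c f h] by (simp add: wdot_commute[of \<gamma> h])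

section \<open>The dilation group and its generator\<close>

lemma euler_eq_frechet: "f differentiable at x \<Longrightarrow> euler f x = frechet_derivative f (at x) x"
  by (simp add: euler_def frechet_derivative_eq_sum_partial)

text \<open>The curve \<open>exp t *\<^sub>R x\<close> is its own velocity, so the chain rule yields
  \<open>euler f\<close> at the dilated point; the prefactor contributes the zero-order term of
  \<open>skew_euler\<close>.\<close>

lemma dilation_deriv:
  fixes f :: "real^'n::finite \<Rightarrow> real"
  assumes "Ck_away0 1 f"
  shows "((\<lambda>t. dilation \<gamma> t f x) has_real_derivative dilation \<gamma> t (skew_euler \<gamma> f) x) (at t within S)"
proof -
  let ?c = "(real CARD('n) - \<gamma>) / 2"
  have d: "f differentiable at y" for y
    using assms by (simp add: Ck_away0_def)
  have 1: "((\<lambda>t. exp t *\<^sub>R x) has_derivative (\<lambda>h. (h * exp t) *\<^sub>R x)) (at t within S)"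
    by (auto intro!: derivative_eq_intros)
  have "((\<lambda>t. f (exp t *\<^sub>R x)) has_derivative
      (\<lambda>h. frechet_derivative f (at (exp t *\<^sub>R x)) ((h * exp t) *\<^sub>R x))) (at t within S)"
    by (rule has_derivative_compose[OF 1 d[unfolded frechet_derivative_works]])
  moreover have "frechet_derivative f (at (exp t *\<^sub>R x)) ((h * exp t) *\<^sub>R x) = euler f (exp t *\<^sub>R x) * h" for h
    unfolding euler_eq_frechet[OF d] scaleR_scaleR[symmetric]
    using linear_scale[OF linear_frechet_derivative[OF d], of "exp t *\<^sub>R x" h "exp t *\<^sub>R x"]
    by simp
  ultimately have "((\<lambda>t. f (exp t *\<^sub>R x)) has_real_derivative euler f (exp t *\<^sub>R x)) (at t within S)"
    by (simp add: has_field_derivative_def)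
  moreover have "((\<lambda>t. exp (c * t)) has_real_derivative exp (c * t) * c) (at t within S)" for c
    by (auto intro!: derivative_eq_intros)
  ultimately have "((\<lambda>t. exp (?c * t) * f (exp t *\<^sub>R x)) has_real_derivative
      exp (?c * t) * ?c * f (exp t *\<^sub>R x) + euler f (exp t *\<^sub>R x) * exp (?c * t)) (at t within S)"
    by (rule DERIV_mult[rotated])
  then show ?thesis
    unfolding dilation_def skew_euler_def distrib_left by (simp only: mult_ac add_ac)
qed

text \<open>Differentiation under the integral. Asking only continuity of \<open>g\<close> makes the
  rule applicable to second-order expressions such as \<open>sphere_lap v\<close>.\<close>

lemma wdot_dilation_deriv:
  fixes f :: "real^'n::finite \<Rightarrow> real"
  assumes f: "Ck_away0 1 f" and g: "Ck_away0 0 g"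
  shows "((\<lambda>t. wdot \<gamma> (dilation \<gamma> t f) g) has_real_derivative
      wdot \<gamma> (dilation \<gamma> t (skew_euler \<gamma> f)) g) (at t)"
proof -
  \<comment> \<open>The support of the dilated \<open>f\<close> moves with t; that of
    \<open>g\<close> times the weight does not, so it supplies one box \<open>B\<close> valid for
    all t.\<close>
  define w where "w x = g x * norm x powr (-\<gamma>)" for x
  have w: "Ck_away0 0 w"
    unfolding w_def[abs_def] by (rule Ck_away0_mult_weight[OF g])
  obtain b where b: "\<And>x. w x \<noteq> 0 \<Longrightarrow> norm x \<le> b"
    using Ck_away0_bounded_support[OF w] by blast
  define B :: "(real^'n) set" where "B = cbox (- (\<Sum>i\<in>Basis. b *\<^sub>R i)) (\<Sum>i\<in>Basis. b *\<^sub>R i)"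
  have wB: "w x = 0" if "x \<notin> B" for x
    using b norm_le_imp_mem_cbox that unfolding B_def by blast
  have cont: "continuous_on S (\<lambda>p. dilation \<gamma> (s p) h (y p) * w (y p))"
    if "Ck_away0 0 h" "continuous_on S s" "continuous_on S y"
    for h and S :: "'b::topological_space set" and s y
    unfolding dilation_def
    by (intro continuous_intros that continuous_on_compose2[OF Ck_away0_continuous[OF w, of UNIV]]
       continuous_on_compose2[OF Ck_away0_continuous[OF that(1), of UNIV]]) auto
  have f0: "Ck_away0 0 f" using f by (rule Ck_away0_mono) simp
  have eq: "wdot \<gamma> (dilation \<gamma> t h) g = integral B (\<lambda>x. dilation \<gamma> t h x * w x)" if "Ck_away0 0 h" for h t
  proof -
    have "wdot \<gamma> (dilation \<gamma> t h) g = (LINT x|lborel. dilation \<gamma> t h x * w x)"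
      by (simp add: wdot_def w_def mult.assoc)
    also have "\<dots> = integral B (\<lambda>x. dilation \<gamma> t h x * w x)"
      unfolding B_def
      by (rule integrable_continuous_vanishing(2)[OF cont[OF that]])
         (auto intro!: continuous_intros wB simp: B_def)
    finally show ?thesis .
  qed
  have "((\<lambda>t. integral B (\<lambda>x. dilation \<gamma> t f x * w x)) has_real_derivative
      integral B (\<lambda>x. dilation \<gamma> t (skew_euler \<gamma> f) x * w x)) (at t within UNIV)"
    unfolding B_def
  proof (rule leibniz_rule_field_derivative)
    show "((\<lambda>t. dilation \<gamma> t f x * w x) has_real_derivative dilation \<gamma> t (skew_euler \<gamma> f) x * w x) (at t within UNIV)" for t x
      by (rule DERIV_cmult_right[OF dilation_deriv[OF f]])
    show "(\<lambda>x. dilation \<gamma> t f x * w x) integrable_on cbox a b" for t a b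
      by (intro integrable_continuous cont f0 continuous_intros)
    show "continuous_on (UNIV \<times> cbox a b) (\<lambda>(t, x). dilation \<gamma> t (skew_euler \<gamma> f) x * w x)" for a b
      unfolding case_prod_unfold by (intro cont C0_away0_skew_euler f continuous_intros)
  qed auto
  then show ?thesis
    by (simp add: eq[OF f0] eq[OF C0_away0_skew_euler[OF f]])
qed

text \<open>Unitarity of the group, by the substitution of \<open>exp t *\<^sub>R x\<close> for
  x.\<close>

lemma wdot_dilation:
  fixes f :: "real^'n::finite \<Rightarrow> real"
  assumes f: "Ck_away0 0 f" and g: "Ck_away0 0 g"
  shows "wdot \<gamma> (dilation \<gamma> t f) g = wdot \<gamma> f (dilation \<gamma> (-t) g)"
proof -
  let ?c = "(real CARD('n) - \<gamma>) / 2" and ?F = "\<lambda>x. f x * dilation \<gamma> (-t) g x * norm x powr (-\<gamma>)"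
  have [measurable]: "f \<in> borel_measurable borel" "g \<in> borel_measurable borel"
    using f g by (auto intro!: borel_measurable_continuous_onI Ck_away0_continuous)
  have M: "?F \<in> borel_measurable borel"
    unfolding dilation_def by measurable
  have "wdot \<gamma> f (dilation \<gamma> (-t) g) = integral\<^sup>L lborel ?F"
    by (simp add: wdot_def)
  also have "\<dots> = integral\<^sup>L (density (distr lborel borel (\<lambda>x. 0 + exp t *\<^sub>R x)) (\<lambda>_. \<bar>exp t\<bar>^DIM(real^'n))) ?F"
    by (subst lborel_affine[of "exp t" 0]) (simp_all add: ennreal_power)
  also have "\<dots> = (LINT x|lborel. exp t ^ CARD('n) * ?F (exp t *\<^sub>R x))"
    using M by (simp add: integral_density integral_distr)
  also have "\<dots> = wdot \<gamma> (dilation \<gamma> t f) g"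
    unfolding wdot_def
  proof (rule Bochner_Integration.integral_cong[OF refl])
    fix x :: "real^'n"
    have "norm (exp t *\<^sub>R x) powr (-\<gamma>) = exp (-\<gamma> * t) * norm x powr (-\<gamma>)"
      by (simp add: powr_mult powr_def[of "exp t"])
    moreover have "exp t ^ CARD('n) = exp (real CARD('n) * t)"
      by (simp add: exp_of_nat_mult)
    \<comment> \<open>Jacobian, prefactor and weight combine: n - c - \<gamma> = c because 2 c = n -
      \<gamma>, which is why the prefactor has this exponent.\<close>
    moreover have "exp (real CARD('n) * t) * exp (?c * (-t)) * exp (-\<gamma> * t) = exp (?c * t)"
      by (simp add: exp_add[symmetric] field_simps)
    ultimately show "exp t ^ CARD('n) * ?F (exp t *\<^sub>R x) = dilation \<gamma> t f x * g x * norm x powr (-\<gamma>)"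
      unfolding dilation_def by (simp add: exp_minus scaleR_scaleR mult_ac)
  qed
  finally show ?thesis by simp
qed

lemma dilation_0 [simp]: "dilation \<gamma> 0 f = f"
  by (simp add: fun_eq_iff dilation_def)

text \<open>The generator of a unitary group is skew: both sides are the derivative at t = 0 of the
  two expressions equated by \<open>wdot_dilation\<close>.\<close>

lemma wdot_skew_euler:
  assumes f: "Ck_away0 1 f" and g: "Ck_away0 1 g"
  shows "wdot \<gamma> (skew_euler \<gamma> f) g = - wdot \<gamma> f (skew_euler \<gamma> g)"
proof -
  have f0: "Ck_away0 0 f" and g0: "Ck_away0 0 g" using assms Ck_away0_mono by (metis zero_le)+
  have "((\<lambda>t. wdot \<gamma> (dilation \<gamma> t f) g) has_real_derivative wdot \<gamma> (skew_euler \<gamma> f) g) (at 0)"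
    using wdot_dilation_deriv[OF f g0, of \<gamma> 0] by simp
  moreover have "((\<lambda>t. wdot \<gamma> (dilation \<gamma> (-t) g) f) has_real_derivative wdot \<gamma> (skew_euler \<gamma> g) f * (-1)) (at 0)"
    by (rule DERIV_chain2[of "\<lambda>t. wdot \<gamma> (dilation \<gamma> t g) f"])
       (use wdot_dilation_deriv[OF g f0, of \<gamma> 0] in \<open>auto intro!: derivative_eq_intros\<close>)
  ultimately have "wdot \<gamma> (skew_euler \<gamma> f) g = wdot \<gamma> (skew_euler \<gamma> g) f * (-1)"
    by (intro DERIV_unique[of "\<lambda>t. wdot \<gamma> (dilation \<gamma> t f) g"])
       (simp_all only: wdot_dilation[OF f0 g0] wdot_commute[of _ f "dilation _ _ _"])
  then show ?thesis
    by (simp add: wdot_commute[of _ f])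
qed

section \<open>Integration by parts\<close>

lemma integral_translate:
  fixes f :: "'a::euclidean_space \<Rightarrow> real"
  assumes "f \<in> borel_measurable borel"
  shows "(LINT x|lborel. f (c + x)) = (LINT x|lborel. f x)"
proof -
  have "(LINT x|lborel. f x) = (LINT x|distr lborel borel ((+) c). f x)"
    by (subst lborel_distr_plus) simp
  also have "\<dots> = (LINT x|lborel. f (c + x))"
    using assms by (intro integral_distr) auto
  finally show ?thesis ..
qed

text \<open>By translation invariance the integral of F(t e_i + x) does not depend on t, while its
  derivative at t = 0 is the integral of \<open>partial i F\<close>.\<close>

lemma integral_partial_eq_0:
  fixes F :: "real^'n::finite \<Rightarrow> real"
  assumes F: "Ck_away0 1 F"
  shows "(LINT x|lborel. partial i F x) = 0"
proof -
  have pF: "Ck_away0 0 (partial i F)"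
    using Ck_away0_partial[of 0] F by simp
  obtain b1 where b1: "\<And>x. F x \<noteq> 0 \<Longrightarrow> norm x \<le> b1"
    using Ck_away0_bounded_support[OF F] by blast
  obtain b2 where b2: "\<And>x. partial i F x \<noteq> 0 \<Longrightarrow> norm x \<le> b2"
    using Ck_away0_bounded_support[OF pF] by blast
  \<comment> \<open>The margin 1 keeps the supports of all translates with |t| < 1 inside one box
    \<open>B\<close>.\<close>
  define b where "b = max b1 b2 + 1"
  define B :: "(real^'n) set" where "B = cbox (- (\<Sum>i\<in>Basis. b *\<^sub>R i)) (\<Sum>i\<in>Basis. b *\<^sub>R i)"
  have d: "F differentiable at x" for x
    using F by (simp add: Ck_away0_def)
  have cont: "continuous_on S (\<lambda>p. h (s p *\<^sub>R axis i 1 + y p))"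
    if "Ck_away0 0 h" "continuous_on S s" "continuous_on S y"
    for h :: "real^'n \<Rightarrow> real" and S :: "'b::topological_space set" and s y
    by (intro continuous_intros that continuous_on_compose2[OF Ck_away0_continuous[OF that(1), of UNIV]]) auto
  have F0: "Ck_away0 0 F" using F by (rule Ck_away0_mono) simp
  have out: "F (t *\<^sub>R axis i 1 + x) = 0" if "\<bar>t\<bar> < 1" "x \<notin> B" for t x
  proof (rule ccontr)
    assume "F (t *\<^sub>R axis i 1 + x) \<noteq> 0"
    then have "norm (t *\<^sub>R axis i 1 + x) \<le> b1" by (rule b1)
    moreover have "norm x \<le> norm (t *\<^sub>R axis i 1 + x) + norm (t *\<^sub>R axis i (1::real))"
      by (metis add.commute add_diff_cancel_left' norm_triangle_ineq4)
    ultimately have "norm x \<le> b"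
      using that(1) by (simp add: b_def)
    with that(2) show False
      using norm_le_imp_mem_cbox unfolding B_def by blast
  qed
  have out': "partial i F x = 0" if "x \<notin> B" for x
  proof (rule ccontr)
    assume "partial i F x \<noteq> 0"
    then have "norm x \<le> b" using b2 by (fastforce simp: b_def)
    with that show False
      using norm_le_imp_mem_cbox unfolding B_def by blast
  qed
  have const: "integral B (\<lambda>x. F (t *\<^sub>R axis i 1 + x)) = (LINT x|lborel. F x)" if "\<bar>t\<bar> < 1" for t
  proof -
    have "(LINT x|lborel. F (t *\<^sub>R axis i 1 + x)) = integral B (\<lambda>x. F (t *\<^sub>R axis i 1 + x))"
      unfolding B_def
      by (rule integrable_continuous_vanishing(2)[OF cont[OF F0]])
         (auto intro!: continuous_intros out[OF that] simp: B_def)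
    moreover have "F \<in> borel_measurable borel"
      by (intro borel_measurable_continuous_onI Ck_away0_continuous[OF F])
    ultimately show ?thesis
      by (simp add: integral_translate)
  qed
  have "((\<lambda>t. integral B (\<lambda>x. F (t *\<^sub>R axis i 1 + x))) has_real_derivative
      integral B (\<lambda>x. partial i F (0 *\<^sub>R axis i 1 + x))) (at 0 within {-1<..<1})"
    unfolding B_def
  proof (rule leibniz_rule_field_derivative)
    show "((\<lambda>t. F (t *\<^sub>R axis i 1 + x)) has_real_derivative partial i F (t *\<^sub>R axis i 1 + x))
        (at t within {-1<..<1})" for t x
    proof -
      have "((\<lambda>t. t *\<^sub>R axis i 1 + x) has_derivative (\<lambda>h. h *\<^sub>R axis i 1)) (at t within {-1<..<1})"
        by (auto intro!: derivative_eq_intros)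
      from has_derivative_compose[OF this d[unfolded frechet_derivative_works]]
      show ?thesis
        unfolding has_field_derivative_def partial_def
        by (simp add: linear_scale[OF linear_frechet_derivative[OF d]] mult.commute[of _ "frechet_derivative _ _ _"])
    qed
    show "(\<lambda>x. F (t *\<^sub>R axis i 1 + x)) integrable_on cbox a b" for t a b
      by (intro integrable_continuous cont F0 continuous_intros)
    show "continuous_on ({-1<..<1} \<times> cbox a b) (\<lambda>(t, x). partial i F (t *\<^sub>R axis i 1 + x))" for a b
      unfolding case_prod_unfold by (intro cont pF continuous_intros)
  qed auto
  then have "((\<lambda>t. integral B (\<lambda>x. F (t *\<^sub>R axis i 1 + x))) has_real_derivative
      integral B (partial i F)) (at 0)"
    by (simp add: at_within_open[of _ "{-1<..<1}"])
  moreover have "((\<lambda>t. integral B (\<lambda>x. F (t *\<^sub>R axis i 1 + x))) has_real_derivative 0) (at 0)"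
    by (rule has_field_derivative_transform_within_open[OF DERIV_const, of "{-1<..<1}"])
       (auto simp: const)
  ultimately have "integral B (partial i F) = 0"
    by (rule DERIV_unique)
  moreover have "(LINT x|lborel. partial i F x) = integral B (partial i F)"
    unfolding B_def
    by (rule integrable_continuous_vanishing(2)[OF Ck_away0_continuous[OF pF]]) (auto intro!: out' simp: B_def)
  ultimately show ?thesis by simp
qed

section \<open>The spherical Laplacian and its quadratic form\<close>

text \<open>\<open>sphere_lap v\<close> is \<open>r\<^sup>2 (\<Delta> - \<Delta>_r) v\<close>, the Laplace-Beltrami operator of the sphere.\<close>

definition sphere_lap :: "(real^'n::finite \<Rightarrow> real) \<Rightarrow> real^'n \<Rightarrow> real" where
  "sphere_lap v x = lap v x * (norm x)\<^sup>2 - euler (euler v) x - (real CARD('n) - 2) * euler v x"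

lemma Ck_away0_sphere_lap:
  fixes v :: "real^'n::finite \<Rightarrow> real"
  assumes "Ck_away0 2 v"
  shows "Ck_away0 0 (sphere_lap v)"
proof -
  have "Ck_away0 0 (\<lambda>x. lap v x * (norm x)\<^sup>2 + (-1) * euler (euler v) x + (2 - real CARD('n)) * euler v x)"
    using assms Ck_away0_euler[OF assms]
    by (intro Ck_away0_add C0_away0_cmult C0_away0_euler Ck_away0_mult_continuous[of 0 "lap v"] Ck_away0_lap continuous_intros)
       (auto simp: numeral_2_eq_2 intro: Ck_away0_mono)
  then show ?thesis
    unfolding sphere_lap_def[abs_def] by (simp add: algebra_simps)
qed

lemma C0_away0_angular_grad: "Ck_away0 1 f \<Longrightarrow> Ck_away0 0 (angular_grad j f)"
  unfolding angular_grad_alt[abs_def]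
  by (intro Ck_away0_add C0_away0_cmult Ck_away0_mult_weight C0_away0_euler Ck_away0_partial
       Ck_away0_mult_continuous[of 0 "\<lambda>x. euler f x * norm x powr - 1"] C1_off0_continuous[OF C1_off0_component])
     simp_all

lemma wdot_euler:
  fixes f :: "real^'n::finite \<Rightarrow> real"
  assumes f: "Ck_away0 1 f" and g: "Ck_away0 1 g"
  shows "wdot \<gamma> (euler f) g + wdot \<gamma> f (euler g) = (\<gamma> - real CARD('n)) * wdot \<gamma> f g"
proof -
  have f0: "Ck_away0 0 f" and g0: "Ck_away0 0 g" using assms Ck_away0_mono by (metis zero_le)+
  have "wdot \<gamma> (skew_euler \<gamma> f) g = wdot \<gamma> (euler f) g + (real CARD('n) - \<gamma>) / 2 * wdot \<gamma> f g"
    unfolding skew_euler_def[abs_def]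
    by (simp only: wdot_add_left wdot_cmult_left C0_away0_euler[OF f] f0 g0 C0_away0_cmult)
  moreover have "wdot \<gamma> f (skew_euler \<gamma> g) = wdot \<gamma> f (euler g) + (real CARD('n) - \<gamma>) / 2 * wdot \<gamma> f g"
    unfolding skew_euler_def[abs_def]
    by (simp only: wdot_add_right wdot_cmult_right C0_away0_euler[OF g] f0 g0 C0_away0_cmult)
  ultimately show ?thesis
    using wdot_skew_euler[OF f g, of \<gamma>] by (simp add: field_simps)
qed

text \<open>Pythagoras: \<open>angular_grad\<close> is r times the component of the gradient
  orthogonal to x. The two mixed terms and the term with the sum of the squares of
  \<open>x $ j\<close> leave one copy of the radial product, with a minus sign.\<close>

lemma sum_angular_grad_mult:
  assumes "x \<noteq> 0"
  shows "(\<Sum>j\<in>UNIV. angular_grad j f x * angular_grad j g x) =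
      (norm x)\<^sup>2 * (\<Sum>j\<in>UNIV. partial j f x * partial j g x) - euler f x * euler g x"
proof -
  have n: "(\<Sum>i\<in>UNIV. x $ i * x $ i) = (norm x)\<^sup>2"
    by (simp add: power2_norm_eq_inner inner_vec_def)
  have "angular_grad j f x * angular_grad j g x = (norm x)\<^sup>2 * (partial j f x * partial j g x)
      - x $ j * partial j f x * euler g x - x $ j * partial j g x * euler f x
      + (x $ j * x $ j) * (euler f x * euler g x / (norm x)\<^sup>2)" for j
    using assms by (simp add: angular_grad_def field_simps power2_eq_square)
  then have "(\<Sum>j\<in>UNIV. angular_grad j f x * angular_grad j g x) =
      (norm x)\<^sup>2 * (\<Sum>j\<in>UNIV. partial j f x * partial j g x)
      - euler f x * euler g x - euler g x * euler f x + (norm x)\<^sup>2 * (euler f x * euler g x / (norm x)\<^sup>2)"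
    by (simp only: sum.distrib sum_subtractf sum_distrib_left[symmetric] sum_distrib_right[symmetric] n euler_def[symmetric])
  then show ?thesis
    using assms by simp
qed

text \<open>Green's identity on spheres, obtained from the divergence theorem in the whole space
  after removing the radial contributions.\<close>

lemma wdot_sphere_lap:
  fixes f v :: "real^'n::finite \<Rightarrow> real"
  assumes f: "Ck_away0 1 f" and v: "Ck_away0 2 v"
  shows "wdot \<gamma> f (sphere_lap v) =
      - (\<Sum>j\<in>UNIV. wdot \<gamma> (angular_grad j f) (angular_grad j v))"
proof -
  let ?N = "real CARD('n)"
  \<comment> \<open>The vector field f r^(2-\<gamma>) grad v; the extra r^2 produces the factors r
    in \<open>angular_grad\<close> and r^2 in \<open>sphere_lap\<close>.\<close>
  define F where "F i x = f x * partial i v x * norm x powr (2 - \<gamma>)" for i x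
  have v1: "Ck_away0 1 v" using v by (rule Ck_away0_mono) simp
  have f0: "Ck_away0 0 f" using f by (rule Ck_away0_mono) simp
  have pv: "Ck_away0 1 (partial i v)" for i
    using v by (intro Ck_away0_partial) (simp add: numeral_2_eq_2)
  have fp: "Ck_away0 1 (\<lambda>x. f x * partial i v x)" for i
    by (intro C1_away0_mult f pv)
  have F: "Ck_away0 1 (F i)" for i
    unfolding F_def[abs_def] by (intro Ck_away0_mult_powr fp)
  have ev: "Ck_away0 1 (euler v)" by (rule Ck_away0_euler[OF v])
  have c0: "Ck_away0 0 (euler v)" "Ck_away0 0 (euler f)" "Ck_away0 0 (euler (euler v))" "Ck_away0 0 (sphere_lap v)"
      "Ck_away0 0 (angular_grad j f)" "Ck_away0 0 (angular_grad j v)" for j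
    using C0_away0_euler[OF v1] C0_away0_euler[OF f] C0_away0_euler[OF ev] Ck_away0_sphere_lap[OF v]
      C0_away0_angular_grad[OF f] C0_away0_angular_grad[OF v1] by auto
  \<comment> \<open>Its divergence, split into angular and radial parts. The coefficient of the last
    term is (2 - \<gamma>) from the weight plus (n - 2) from \<open>sphere_lap\<close>.\<close>
  have pt: "(\<Sum>i\<in>UNIV. partial i (F i) x) =
      (\<Sum>j\<in>UNIV. angular_grad j f x * angular_grad j v x * norm x powr (-\<gamma>)) + euler f x * euler v x * norm x powr (-\<gamma>)
      + f x * sphere_lap v x * norm x powr (-\<gamma>) + f x * euler (euler v) x * norm x powr (-\<gamma>)
      + (?N - \<gamma>) * (f x * euler v x * norm x powr (-\<gamma>))" (is "?L = ?R") for x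
  proof (cases "x = 0")
    case True
    then show ?thesis
      using Ck_away0_0[OF Ck_away0_partial, of 0, OF F[unfolded One_nat_def]] f0 by simp
  next
    case False
    define w where "w = norm x powr (-\<gamma>)"
    have w2: "norm x powr (2 - \<gamma>) = (norm x)\<^sup>2 * w"
      using False by (simp add: w_def powr_diff powr_minus_divide)
    have "partial i (F i) x = (norm x)\<^sup>2 * (partial i f x * partial i v x) * w
        + f x * (norm x)\<^sup>2 * w * partial i (partial i v) x + (2 - \<gamma>) * f x * w * (x $ i * partial i v x)" for i
      unfolding F_def[abs_def] partial_mult_C1[OF fp C1_off0_norm_powr] partial_mult_C1[OF f C1_away0_imp_C1_off0[OF pv]]
        partial_norm_powr[OF False]
      using w2 by (simp add: w_def algebra_simps)
    then have "?L = (norm x)\<^sup>2 * (\<Sum>i\<in>UNIV. partial i f x * partial i v x) * w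
        + f x * (norm x)\<^sup>2 * w * lap v x + (2 - \<gamma>) * f x * w * euler v x"
      by (simp only: sum.distrib sum_distrib_left[symmetric] sum_distrib_right[symmetric] lap_def[symmetric] euler_def[symmetric])
    also have "\<dots> = ((\<Sum>j\<in>UNIV. angular_grad j f x * angular_grad j v x) + euler f x * euler v x) * w
        + f x * (norm x)\<^sup>2 * w * lap v x + (2 - \<gamma>) * f x * w * euler v x"
      unfolding sum_angular_grad_mult[OF False] by simp
    also have "\<dots> = ?R"
      unfolding w_def[symmetric] sum_distrib_right[symmetric] by (simp add: sphere_lap_def algebra_simps)
    finally show ?thesis .
  qed
  have "0 = (\<Sum>i\<in>UNIV. LINT x|lborel. partial i (F i) x)"
    by (simp add: integral_partial_eq_0[OF F])
  also have "\<dots> = (LINT x|lborel. (\<Sum>i\<in>UNIV. partial i (F i) x))"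
    using F by (intro Bochner_Integration.integral_sum[symmetric] integrable_Ck_away0[of 0] Ck_away0_partial) simp
  also have "\<dots> = (\<Sum>j\<in>UNIV. wdot \<gamma> (angular_grad j f) (angular_grad j v)) + wdot \<gamma> (euler f) (euler v) + wdot \<gamma> f (sphere_lap v)
      + wdot \<gamma> f (euler (euler v)) + (?N - \<gamma>) * wdot \<gamma> f (euler v)"
    unfolding pt wdot_def using c0 f0
    by (simp add: integrable_wdot)
  \<comment> \<open>The three purely radial terms cancel by skewness, applied to \<open>f\<close>
    and \<open>euler v\<close>.\<close>
  finally show ?thesis
    using wdot_euler[OF f ev, of \<gamma>] by (simp add: algebra_simps)
qed

section \<open>Dilations acting on the angular gradient\<close>

lemma dilation_differentiable:
  fixes f :: "real^'n::finite \<Rightarrow> real"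
  assumes "Ck_away0 1 f"
  shows "dilation \<gamma> t f differentiable at x" "partial i (dilation \<gamma> t f) x = exp t * dilation \<gamma> t (partial i f) x"
proof -
  have d: "f differentiable at y" for y
    using assms by (simp add: Ck_away0_def)
  have "((\<lambda>x. exp t *\<^sub>R x) has_derivative (\<lambda>h. exp t *\<^sub>R h)) (at x)"
    by (auto intro!: derivative_eq_intros)
  from has_derivative_compose[OF this d[unfolded frechet_derivative_works]]
  have "((\<lambda>x. f (exp t *\<^sub>R x)) has_derivative (\<lambda>h. exp t * frechet_derivative f (at (exp t *\<^sub>R x)) h)) (at x)"
    by (simp add: linear_scale[OF linear_frechet_derivative[OF d]])
  from has_derivative_mult_right[OF this, of "exp ((real CARD('n) - \<gamma>) / 2 * t)"]
  have D: "(dilation \<gamma> t f has_derivative (\<lambda>h. exp ((real CARD('n) - \<gamma>) / 2 * t) *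
      (exp t * frechet_derivative f (at (exp t *\<^sub>R x)) h))) (at x)"
    unfolding dilation_def[abs_def] .
  show "dilation \<gamma> t f differentiable at x"
    by (rule differentiableI[OF D])
  show "partial i (dilation \<gamma> t f) x = exp t * dilation \<gamma> t (partial i f) x"
    using partial_eqI[OF D] by (simp add: dilation_def partial_def)
qed

lemma C0_away0_dilation:
  fixes f :: "real^'n::finite \<Rightarrow> real"
  assumes "Ck_away0 0 f"
  shows "Ck_away0 0 (dilation \<gamma> t f)"
proof -
  obtain a b where "a > 0" and ab: "\<And>x. f x \<noteq> 0 \<Longrightarrow> a \<le> norm x \<and> norm x \<le> b"
    using assms unfolding Ck_away0_def compact_support_away0_iff by blast
  moreover have "a / exp t \<le> norm x \<and> norm x \<le> b / exp t" if "dilation \<gamma> t f x \<noteq> 0" for x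
    using ab[of "exp t *\<^sub>R x"] that by (simp add: dilation_def field_simps)
  ultimately have "compact_support_away0 (dilation \<gamma> t f)"
    unfolding compact_support_away0_iff by (metis divide_pos_pos exp_gt_zero)
  moreover have "continuous_on UNIV (dilation \<gamma> t f)"
    unfolding dilation_def[abs_def]
    by (intro continuous_intros continuous_on_compose2[OF Ck_away0_continuous[OF assms, of UNIV]]) auto
  ultimately show ?thesis
    by (simp add: Ck_away0_def)
qed

lemma Ck_away0_dilation:
  assumes "Ck_away0 1 f"
  shows "Ck_away0 1 (dilation \<gamma> t f)"
proof -
  have "partial i (dilation \<gamma> t f) = (\<lambda>x. exp t * dilation \<gamma> t (partial i f) x)" for i
    using dilation_differentiable(2)[OF assms] by blast
  moreover have "Ck_away0 0 (\<lambda>x. exp t * dilation \<gamma> t (partial i f) x)" for i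
    using assms by (intro C0_away0_cmult C0_away0_dilation Ck_away0_partial) simp
  moreover have "Ck_away0 0 (dilation \<gamma> t f)"
    by (rule C0_away0_dilation[OF Ck_away0_mono[OF assms]]) simp
  ultimately show ?thesis
    using dilation_differentiable(1)[OF assms] by (simp add: Ck_away0_def)
qed

text \<open>Homogeneity of degree 0: the factor \<open>exp t\<close> from each derivative is
  absorbed by the factor \<open>norm x\<close> or \<open>x $ i\<close> next to it. Only first
  derivatives enter.\<close>

lemma angular_grad_dilation:
  assumes "Ck_away0 1 f"
  shows "angular_grad j (dilation \<gamma> t f) = dilation \<gamma> t (angular_grad j f)"
proof
  fix x
  have "euler (dilation \<gamma> t f) x = dilation \<gamma> t (euler f) x"
    by (simp add: euler_def dilation_differentiable(2)[OF assms] dilation_def sum_distrib_left mult_ac)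
  then show "angular_grad j (dilation \<gamma> t f) x = dilation \<gamma> t (angular_grad j f) x"
    by (simp add: angular_grad_def dilation_differentiable(2)[OF assms]) (simp add: dilation_def algebra_simps angular_grad_def)
qed

text \<open>Differentiating the identity for \<open>wdot \<gamma> (dilation \<gamma> t v) (sphere_lap v)\<close> in \<open>t\<close>
  replaces the commutation of the Euler operator with \<open>angular_grad j\<close>.\<close>

lemma wdot_dilation_skew_euler_sphere_lap:
  assumes v: "Ck_away0 2 v"
  shows "wdot \<gamma> (dilation \<gamma> t (skew_euler \<gamma> v)) (sphere_lap v) =
      - (\<Sum>j\<in>UNIV. wdot \<gamma> (dilation \<gamma> t (skew_euler \<gamma> (angular_grad j v))) (angular_grad j v))"
proof (rule DERIV_unique)
  have v1: "Ck_away0 1 v" using v by (rule Ck_away0_mono) simp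
  show "((\<lambda>t. wdot \<gamma> (dilation \<gamma> t v) (sphere_lap v)) has_real_derivative
      wdot \<gamma> (dilation \<gamma> t (skew_euler \<gamma> v)) (sphere_lap v)) (at t)"
    by (rule wdot_dilation_deriv[OF v1 Ck_away0_sphere_lap[OF v]])
  have "wdot \<gamma> (dilation \<gamma> t v) (sphere_lap v) =
      - (\<Sum>j\<in>UNIV. wdot \<gamma> (dilation \<gamma> t (angular_grad j v)) (angular_grad j v))" for t
    by (simp only: wdot_sphere_lap[OF Ck_away0_dilation[OF v1] v] angular_grad_dilation[OF v1])
  moreover have "((\<lambda>t. - (\<Sum>j\<in>UNIV. wdot \<gamma> (dilation \<gamma> t (angular_grad j v)) (angular_grad j v))) has_real_derivative
      - (\<Sum>j\<in>UNIV. wdot \<gamma> (dilation \<gamma> t (skew_euler \<gamma> (angular_grad j v))) (angular_grad j v))) (at t)"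
    by (intro DERIV_minus DERIV_sum wdot_dilation_deriv Ck_away0_angular_grad[OF v] C0_away0_angular_grad[OF v1])
  ultimately show "((\<lambda>t. wdot \<gamma> (dilation \<gamma> t v) (sphere_lap v)) has_real_derivative
      - (\<Sum>j\<in>UNIV. wdot \<gamma> (dilation \<gamma> t (skew_euler \<gamma> (angular_grad j v))) (angular_grad j v))) (at t)"
    by simp
qed

lemma wdot_skew_euler_self: "Ck_away0 1 f \<Longrightarrow> wdot \<gamma> (skew_euler \<gamma> f) f = 0"
  using wdot_skew_euler[of f f \<gamma>] by (simp add: wdot_commute)

text \<open>At t = 0 each summand pairs \<open>angular_grad j v\<close> with its own image under a
  skew operator.\<close>

lemma wdot_skew_euler_sphere_lap: "Ck_away0 2 v \<Longrightarrow> wdot \<gamma> (skew_euler \<gamma> v) (sphere_lap v) = 0"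
  using wdot_dilation_skew_euler_sphere_lap[of v \<gamma> 0] by (simp add: wdot_skew_euler_self[OF Ck_away0_angular_grad])

lemma wdot_skew_euler_skew_euler_sphere_lap:
  assumes v: "Ck_away0 2 v"
  shows "wdot \<gamma> (skew_euler \<gamma> (skew_euler \<gamma> v)) (sphere_lap v) =
      (\<Sum>j\<in>UNIV. wdot \<gamma> (skew_euler \<gamma> (angular_grad j v)) (skew_euler \<gamma> (angular_grad j v)))"
proof (rule DERIV_unique)
  have v1: "Ck_away0 1 v" using v by (rule Ck_away0_mono) simp
  show "((\<lambda>t. wdot \<gamma> (dilation \<gamma> t (skew_euler \<gamma> v)) (sphere_lap v)) has_real_derivative
      wdot \<gamma> (skew_euler \<gamma> (skew_euler \<gamma> v)) (sphere_lap v)) (at 0)"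
    using wdot_dilation_deriv[OF Ck_away0_skew_euler[OF v] Ck_away0_sphere_lap[OF v], of \<gamma> \<gamma> 0] by simp
  \<comment> \<open>\<open>skew_euler \<gamma> (angular_grad j v)\<close> is known only to be
    continuous, so the dilation is moved to the C^1 function \<open>angular_grad j v\<close> before
    differentiating a second time.\<close>
  have "wdot \<gamma> (dilation \<gamma> t (skew_euler \<gamma> v)) (sphere_lap v) =
      - (\<Sum>j\<in>UNIV. wdot \<gamma> (dilation \<gamma> (-t) (angular_grad j v)) (skew_euler \<gamma> (angular_grad j v)))" for t
    unfolding wdot_dilation_skew_euler_sphere_lap[OF v]
      wdot_dilation[OF C0_away0_skew_euler[OF Ck_away0_angular_grad[OF v]] C0_away0_angular_grad[OF v1]]
    by (simp add: wdot_commute)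
  \<comment> \<open>The inner derivative -1 of -t cancels the minus sign in front of the sum, hence
    the positive squares.\<close>
  moreover have "((\<lambda>t. wdot \<gamma> (dilation \<gamma> (-t) (angular_grad j v)) (skew_euler \<gamma> (angular_grad j v))) has_real_derivative
      wdot \<gamma> (skew_euler \<gamma> (angular_grad j v)) (skew_euler \<gamma> (angular_grad j v)) * (-1)) (at 0)" for j
    by (rule DERIV_chain2[of "\<lambda>t. wdot \<gamma> (dilation \<gamma> t (angular_grad j v)) (skew_euler \<gamma> (angular_grad j v))"])
       (use wdot_dilation_deriv[OF Ck_away0_angular_grad[OF v] C0_away0_skew_euler[OF Ck_away0_angular_grad[OF v]], of \<gamma> j \<gamma> j 0]
          in \<open>auto intro!: derivative_eq_intros\<close>)
  then have "((\<lambda>t. - (\<Sum>j\<in>UNIV. wdot \<gamma> (dilation \<gamma> (-t) (angular_grad j v)) (skew_euler \<gamma> (angular_grad j v)))) has_real_derivative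
      - (\<Sum>j\<in>UNIV. wdot \<gamma> (skew_euler \<gamma> (angular_grad j v)) (skew_euler \<gamma> (angular_grad j v)) * (-1))) (at 0)"
    by (intro DERIV_minus DERIV_sum)
  ultimately show "((\<lambda>t. wdot \<gamma> (dilation \<gamma> t (skew_euler \<gamma> v)) (sphere_lap v)) has_real_derivative
      (\<Sum>j\<in>UNIV. wdot \<gamma> (skew_euler \<gamma> (angular_grad j v)) (skew_euler \<gamma> (angular_grad j v)))) (at 0)"
    by (simp add: sum_negf)
qed

section \<open>The weighted identities\<close>

lemma euler_add:
  assumes "Ck_away0 1 f" "Ck_away0 1 g"
  shows "euler (\<lambda>x. f x + g x) x = euler f x + euler g x"
  using assms by (simp add: euler_def partial_add Ck_away0_def distrib_left sum.distrib)

lemma euler_cmult: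
  assumes "Ck_away0 1 f"
  shows "euler (\<lambda>x. c * f x) x = c * euler f x"
  using partial_mult_C1[OF assms C1_off0_const, of _ c]
  by (simp add: euler_def partial_def mult_ac sum_distrib_left)

lemma euler_skew_euler:
  fixes v :: "real^'n::finite \<Rightarrow> real"
  assumes "Ck_away0 2 v"
  shows "euler (skew_euler \<gamma> v) x = euler (euler v) x + (real CARD('n) - \<gamma>) / 2 * euler v x"
proof -
  have v1: "Ck_away0 1 v" using assms by (rule Ck_away0_mono) simp
  show ?thesis
    unfolding skew_euler_def[abs_def]
    by (simp only: euler_add Ck_away0_euler[OF assms] Ck_away0_cmult[OF v1] euler_cmult[OF v1])
qed

lemma wdot_square_add:
  assumes "Ck_away0 0 f" "Ck_away0 0 g"
  shows "wdot \<gamma> (\<lambda>x. f x + g x) (\<lambda>x. f x + g x) = wdot \<gamma> f f + wdot \<gamma> g g + 2 * wdot \<gamma> f g"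
  using assms by (simp add: wdot_add_left wdot_add_right Ck_away0_add wdot_commute[of \<gamma> g f])

text \<open>In terms of the skew operator \<open>G = skew_euler \<gamma>\<close>, the radial part of \<open>r\<^sup>2 \<Delta>\<close> factors as
  \<open>(G - c) (G + d) = G\<^sup>2 + (d - c) G - c d\<close>.\<close>

lemma wnorm2_lap_scaled:
  fixes v :: "real^'n::finite \<Rightarrow> real" and \<gamma> :: real
  assumes v: "Ck_away0 2 v"
  defines "c \<equiv> (real CARD('n) - \<gamma>) / 2" and "d \<equiv> (real CARD('n) + \<gamma> - 4) / 2"
  shows "wnorm2 \<gamma> (\<lambda>x. lap v x * (norm x)\<^sup>2) =
    (c * d)\<^sup>2 * wnorm2 \<gamma> v + (c\<^sup>2 + d\<^sup>2) * wnorm2 \<gamma> (skew_euler \<gamma> v) + wnorm2 \<gamma> (skew_euler \<gamma> (skew_euler \<gamma> v))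
    + wnorm2 \<gamma> (sphere_lap v) + 2 * (\<Sum>j\<in>UNIV. wnorm2 \<gamma> (skew_euler \<gamma> (angular_grad j v)))
    + 2 * (c * d) * (\<Sum>j\<in>UNIV. wnorm2 \<gamma> (angular_grad j v))"
proof -
  let ?P = "skew_euler \<gamma> (skew_euler \<gamma> v)" and ?Q = "skew_euler \<gamma> v"
  have v1: "Ck_away0 1 v" and v0: "Ck_away0 0 v" using v by (auto intro: Ck_away0_mono)
  have Q1: "Ck_away0 1 ?Q" by (rule Ck_away0_skew_euler[OF v])
  have k: "Ck_away0 0 ?P" "Ck_away0 0 ?Q" "Ck_away0 0 (sphere_lap v)"
    using C0_away0_skew_euler[OF Q1] C0_away0_skew_euler[OF v1] Ck_away0_sphere_lap[OF v] by auto
  have "lap v x * (norm x)\<^sup>2 = ?P x + ((d - c) * ?Q x + (- (c * d) * v x + sphere_lap v x))" for x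
  proof -
    have "?P x = euler (euler v) x + 2 * c * euler v x + c\<^sup>2 * v x" "?Q x = euler v x + c * v x"
      by (simp_all add: skew_euler_def euler_skew_euler[OF v] c_def[symmetric] algebra_simps power2_eq_square)
    \<comment> \<open>With n - 2 = c + d the radial part E^2 + (n - 2) E becomes E (E + c + d), and
      E = G - c gives the factorization.\<close>
    moreover have "real CARD('n) = c + d + 2"
      by (simp add: c_def d_def field_simps)
    ultimately show ?thesis
      by (simp add: sphere_lap_def algebra_simps power2_eq_square)
  qed
  then have eq: "(\<lambda>x. lap v x * (norm x)\<^sup>2) =
      (\<lambda>x. ?P x + ((d - c) * ?Q x + (- (c * d) * v x + sphere_lap v x)))"
    by blast
  have "wnorm2 \<gamma> (\<lambda>x. lap v x * (norm x)\<^sup>2) =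
      wdot \<gamma> ?P ?P + (d - c)\<^sup>2 * wdot \<gamma> ?Q ?Q + (c * d)\<^sup>2 * wdot \<gamma> v v + wdot \<gamma> (sphere_lap v) (sphere_lap v)
      + 2 * (d - c) * wdot \<gamma> ?P ?Q - 2 * (c * d) * wdot \<gamma> ?P v + 2 * wdot \<gamma> ?P (sphere_lap v)
      - 2 * (d - c) * (c * d) * wdot \<gamma> ?Q v + 2 * (d - c) * wdot \<gamma> ?Q (sphere_lap v) - 2 * (c * d) * wdot \<gamma> v (sphere_lap v)"
    unfolding eq wnorm2_eq_wdot
    by (simp only: wdot_square_add wdot_add_left wdot_add_right
        wdot_cmult_left wdot_cmult_right Ck_away0_add C0_away0_cmult k v0)
       (simp add: power2_eq_square algebra_simps)
  \<comment> \<open>This raises the coefficient (d - c)^2 of the square of \<open>?Q\<close> by 2 c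
    d to c^2 + d^2. The pairings of \<open>?Q\<close> with \<open>?P\<close>, \<open>v\<close> and
    \<open>sphere_lap v\<close> vanish by skewness; the other two with \<open>sphere_lap v\<close>
    give the angular sums.\<close>
  moreover have "wdot \<gamma> ?P v = - wdot \<gamma> ?Q ?Q"
    by (rule wdot_skew_euler[OF Q1 v1])
  ultimately show ?thesis
    by (simp add: wdot_skew_euler_self[OF Q1] wdot_skew_euler_self[OF v1]
        wdot_skew_euler_sphere_lap[OF v]
        wdot_skew_euler_skew_euler_sphere_lap[OF v]
        wdot_sphere_lap[OF v1 v] wnorm2_eq_wdot algebra_simps power2_eq_square)
qed

section \<open>Return to the operators of the theorem\<close>

text \<open>The hypothesis leaves out the origin because there both integrands are 0,
  \<open>0 powr s\<close> being 0.\<close>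

lemma wnorm2_weight_shift:
  assumes "\<And>x. x \<noteq> 0 \<Longrightarrow> g x = h x * norm x powr (-s)"
  shows "wnorm2 \<beta> g = wnorm2 (\<beta> + 2 * s) h"
  unfolding wnorm2_def
proof (rule Bochner_Integration.integral_cong[OF refl])
  fix x
  show "(g x)\<^sup>2 * norm x powr - \<beta> = (h x)\<^sup>2 * norm x powr - (\<beta> + 2 * s)"
  proof (cases "x = 0")
    case False
    have "norm x powr - (\<beta> + 2 * s) = norm x powr (-s) * norm x powr (-s) * norm x powr (-\<beta>)"
      by (simp add: powr_add[symmetric] add.commute)
    then show ?thesis
      by (simp add: assms[OF False] power2_eq_square)
  qed simp
qed

lemma radial_deriv_eq_euler: "radial_deriv f x = euler f x * norm x powr (-1)"
  unfolding norm_powr_1 by (simp add: radial_deriv_def euler_def sum_divide_distrib)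

lemma Top_eq_skew_euler: "Top (\<gamma> - 2) f x = skew_euler \<gamma> f x * norm x powr (-1)"
  unfolding Top_def skew_euler_def radial_deriv_eq_euler norm_powr_1
  by (cases "x = 0") (simp_all add: field_simps)

lemma norm_powr_minus_2: "norm x powr (-1) * norm x powr (-1) = norm x powr (-2)"
  unfolding powr_add[symmetric] by simp

text \<open>The factor r^(-1) shifts the Euler operator by -1, and lowering the index from \<gamma>
  - 2 to \<gamma> - 4 adds 1 back; so both factors of \<open>R1\<close> become the same
  \<open>skew_euler \<gamma>\<close>.\<close>

lemma Top_scaled:
  assumes "Ck_away0 1 f"
  shows "Top (\<gamma> - 4) (\<lambda>x. f x * norm x powr (-1)) x = skew_euler \<gamma> f x * norm x powr (-2)"
  unfolding Top_def skew_euler_def radial_deriv_eq_euler euler_mult_powr[OF assms]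
  unfolding norm_powr_minus_2[symmetric] norm_powr_1
  by (cases "x = 0") (simp_all add: field_simps)

text \<open>Applying \<open>radial_deriv\<close> twice gives r^(-2) (E^2 - E), which turns the n - 1
  of \<open>lap_r\<close> into the n - 2 of \<open>sphere_lap\<close>.\<close>

lemma lap_minus_lap_r:
  assumes v: "Ck_away0 2 v" and x: "x \<noteq> 0"
  shows "lap v x - lap_r v x = sphere_lap v x * norm x powr (-2)"
proof -
  have r: "radial_deriv v = (\<lambda>x. euler v x * norm x powr (-1))"
    using radial_deriv_eq_euler by blast
  show ?thesis
    unfolding lap_r_def r radial_deriv_eq_euler euler_mult_powr[OF Ck_away0_euler[OF v]] sphere_lap_def
    unfolding norm_powr_minus_2[symmetric] norm_powr_1
    using x by (simp add: field_simps power2_eq_square)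
qed

text \<open>An equality of functions, origin included, so that it can be rewritten under
  \<open>Top\<close>. At 0 both sides vanish since \<open>partial j v\<close> does.\<close>

lemma Lop_eq_angular_grad:
  assumes "Ck_away0 1 v"
  shows "Lop j v = (\<lambda>x. angular_grad j v x * norm x powr (-1))"
proof
  fix x
  show "Lop j v x = angular_grad j v x * norm x powr (-1)"
    using Ck_away0_0[OF Ck_away0_partial, of 0 v j] assms unfolding norm_powr_1
    by (cases "x = 0") (simp_all add: Lop_def angular_grad_def radial_deriv_eq_euler norm_powr_1 field_simps)
qed

text \<open>The case m = 1. Each operator is r^(-1) or r^(-2) times a dilation-invariant one, so all
  norms move to the common weight \<gamma>.\<close>

lemma wnorm2_lap:
  fixes v :: "real^'n::finite \<Rightarrow> real"
  assumes v: "Ck_away0 2 v"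
  shows "wnorm2 \<beta> (lap v) = (Acoef CARD('n) \<beta>)\<^sup>2 * wnorm2 (\<beta> + 4) v
    + ( Dcoef CARD('n) \<beta> * wnorm2 (\<beta> + 2) (Top (\<beta> + 2) v)
      + wnorm2 \<beta> (R1 \<beta> v)
      + wnorm2 \<beta> (\<lambda>x. lap v x - lap_r v x)
      + 2 * (\<Sum>j\<in>UNIV. wnorm2 \<beta> (Top \<beta> (Lop j v)))
      + 2 * Acoef CARD('n) \<beta> * (\<Sum>j\<in>UNIV. wnorm2 (\<beta> + 2) (Lop j v)))"
proof -
  define \<gamma> where "\<gamma> = \<beta> + 4"
  have \<beta>: "\<beta> = \<gamma> - 4" by (simp add: \<gamma>_def)
  have v1: "Ck_away0 1 v" using v by (rule Ck_away0_mono) simp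
  have T: "Top (\<gamma> - 2) v = (\<lambda>x. skew_euler \<gamma> v x * norm x powr (-1))"
    by (rule ext) (rule Top_eq_skew_euler)
  have "wnorm2 \<beta> (lap v) = wnorm2 \<gamma> (\<lambda>x. lap v x * (norm x)\<^sup>2)"
    unfolding \<beta> by (subst wnorm2_weight_shift[where s = 2]) (auto simp: powr_minus_divide)
  moreover have "wnorm2 (\<gamma> - 2) (Top (\<gamma> - 2) v) = wnorm2 \<gamma> (skew_euler \<gamma> v)"
    unfolding T by (subst wnorm2_weight_shift[where s = 1]) auto
  moreover have "wnorm2 \<beta> (R1 \<beta> v) = wnorm2 \<gamma> (skew_euler \<gamma> (skew_euler \<gamma> v))"
    unfolding R1_def \<beta> using Top_scaled[OF Ck_away0_skew_euler[OF v], of \<gamma> \<gamma>]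
    by (subst wnorm2_weight_shift[where s = 2]) (auto simp: T)
  moreover have "wnorm2 \<beta> (\<lambda>x. lap v x - lap_r v x) = wnorm2 \<gamma> (sphere_lap v)"
    unfolding \<beta> by (subst wnorm2_weight_shift[where s = 2]) (auto simp: lap_minus_lap_r[OF v])
  moreover have "wnorm2 \<beta> (Top \<beta> (Lop j v)) = wnorm2 \<gamma> (skew_euler \<gamma> (angular_grad j v))" for j
    unfolding \<beta> Lop_eq_angular_grad[OF v1]
    by (subst wnorm2_weight_shift[where s = 2, OF Top_scaled[OF Ck_away0_angular_grad[OF v]]]) simp
  moreover have "wnorm2 (\<gamma> - 2) (Lop j v) = wnorm2 \<gamma> (angular_grad j v)" for j
    unfolding Lop_eq_angular_grad[OF v1] by (subst wnorm2_weight_shift[where s = 1]) auto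
  \<comment> \<open>For \<gamma> = \<beta> + 4, n - \<gamma> = n - 4 - \<beta> and n + \<gamma> - 4
    = n + \<beta>.\<close>
  moreover have "Acoef CARD('n) \<beta> = (real CARD('n) - \<gamma>) / 2 * ((real CARD('n) + \<gamma> - 4) / 2)"
    "Dcoef CARD('n) \<beta> = ((real CARD('n) - \<gamma>) / 2)\<^sup>2 + ((real CARD('n) + \<gamma> - 4) / 2)\<^sup>2"
    by (simp_all add: Acoef_def Dcoef_def \<beta> field_simps power2_eq_square)
  moreover have "\<beta> + 4 = \<gamma>" "\<beta> + 2 = \<gamma> - 2"
    by (simp_all add: \<gamma>_def)
  ultimately show ?thesis
    using wnorm2_lap_scaled[OF v, of \<gamma>] by (simp only: add.assoc)
qed

section \<open>Iteration in m\<close>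

text \<open>The shift by 1 lets j = 0 start from the empty product, which is H_(-1) = 1.\<close>

lemma Hcoef_Suc:
  "Hcoef n (int (Suc j) - 1) \<alpha> = Hcoef n (int j - 1) \<alpha> * (Acoef n (\<alpha> + 4 * real j))\<^sup>2"
proof -
  have "{0..int (Suc j) - 1} = insert (int j) {0..int j - 1}" by auto
  then show ?thesis by (simp add: Hcoef_def)
qed

theorem theorem1p2:
  fixes u :: "real^'n::finite \<Rightarrow> real" and m :: nat and \<alpha> :: real
  assumes "m \<ge> 1" and "Ck (2 * m) u" and "compact_support_away0 u"
  shows "wnorm2 \<alpha> ((lap ^^ m) u) =
     Hcoef CARD('n) (int m - 1) \<alpha> * wnorm2 (\<alpha> + 4 * real m) u
     + (\<Sum>k = 1..m. Hcoef CARD('n) (int k - 2) \<alpha> *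
         ( Dcoef CARD('n) (\<alpha> + 4 * real k - 4)
              * wnorm2 (\<alpha> + 4 * real k - 2) (Top (\<alpha> + 4 * real k - 2) ((lap ^^ (m - k)) u))
         + wnorm2 (\<alpha> + 4 * real k - 4) (R1 (\<alpha> + 4 * real k - 4) ((lap ^^ (m - k)) u))
         + wnorm2 (\<alpha> + 4 * real k - 4)
              (\<lambda>x. lap ((lap ^^ (m - k)) u) x - lap_r ((lap ^^ (m - k)) u) x)
         + 2 * (\<Sum>j\<in>UNIV. wnorm2 (\<alpha> + 4 * real k - 4)
                   (Top (\<alpha> + 4 * real k - 4) (Lop j ((lap ^^ (m - k)) u))))
         + 2 * Acoef CARD('n) (\<alpha> + 4 * real k - 4)
              * (\<Sum>j\<in>UNIV. wnorm2 (\<alpha> + 4 * real k - 2) (Lop j ((lap ^^ (m - k)) u)))))"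
    (is "_ = _ + (\<Sum>k = 1..m. _ * ?B k)")
proof -
  have u: "Ck_away0 (2 * m) u"
    using assms by (simp add: Ck_away0_def)
  \<comment> \<open>The case m = 1 with \<beta> = \<alpha> + 4 j, applied to the Laplacian power of
    order m - j - 1; its bracket is the summand k = j + 1.\<close>
  have step: "wnorm2 (\<alpha> + 4 * real j) ((lap ^^ (m - j)) u) =
      (Acoef CARD('n) (\<alpha> + 4 * real j))\<^sup>2 * wnorm2 (\<alpha> + 4 * real (Suc j)) ((lap ^^ (m - Suc j)) u) + ?B (Suc j)"
    if "j < m" for j
  proof -
    let ?v = "(lap ^^ (m - Suc j)) u"
    have "Ck_away0 (2 * Suc j) ?v"
      using Ck_away0_lap_funpow[OF u, of "m - Suc j"] that by simp
    then have "Ck_away0 2 ?v"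
      by (rule Ck_away0_mono) simp
    note wnorm2_lap[OF this, of "\<alpha> + 4 * real j"]
    moreover have "(lap ^^ (m - j)) u = lap ?v"
      using that by (metis Suc_diff_Suc comp_apply funpow.simps(2))
    moreover have "\<alpha> + 4 * real (Suc j) - 4 = \<alpha> + 4 * real j" "\<alpha> + 4 * real (Suc j) - 2 = \<alpha> + 4 * real j + 2"
      "\<alpha> + 4 * real (Suc j) = \<alpha> + 4 * real j + 4"
      by simp_all
    ultimately show ?thesis
      by (simp only:)
  qed
  \<comment> \<open>Induction on the number j of Laplacians peeled off, with m fixed; j = m is the
    claim.\<close>
  have "wnorm2 \<alpha> ((lap ^^ m) u) =
      Hcoef CARD('n) (int j - 1) \<alpha> * wnorm2 (\<alpha> + 4 * real j) ((lap ^^ (m - j)) u)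
      + (\<Sum>k = 1..j. Hcoef CARD('n) (int k - 2) \<alpha> * ?B k)" if "j \<le> m" for j
    using that
  proof (induction j)
    case 0
    then show ?case by (simp add: Hcoef_def)
  next
    case (Suc j)
    let ?H = "Hcoef CARD('n) (int j - 1) \<alpha>" and ?A = "Acoef CARD('n) (\<alpha> + 4 * real j)"
      and ?S = "\<Sum>k = 1..j. Hcoef CARD('n) (int k - 2) \<alpha> * ?B k"
      and ?w = "wnorm2 (\<alpha> + 4 * real (Suc j)) ((lap ^^ (m - Suc j)) u)"
    have "wnorm2 \<alpha> ((lap ^^ m) u) = ?H * (?A\<^sup>2 * ?w + ?B (Suc j)) + ?S"
      using Suc step[of j] by (simp only: Suc_leD Suc_le_lessD)
    also have "\<dots> = ?H * ?A\<^sup>2 * ?w + (?S + ?H * ?B (Suc j))"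
      by (simp only: distrib_left mult.assoc add_ac)
    \<comment> \<open>The old factor, of index j - 1 = (j + 1) - 2, becomes the coefficient of the
      new summand.\<close>
    also have "\<dots> = Hcoef CARD('n) (int (Suc j) - 1) \<alpha> * ?w + (?S + Hcoef CARD('n) (int (Suc j) - 2) \<alpha> * ?B (Suc j))"
      unfolding Hcoef_Suc by simp
    finally show ?case
      by (simp only: sum.atLeast_Suc_atMost sum.cl_ivl_Suc) simp
  qed
  from this[of m] show ?thesis by simp
qed

end
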